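(* Let $\lambda,\mu,\nu>0$, $K<\infty$ a positive integer and $M=K$. Then the solution $p_e(\cdot,\cdot)$ of the balance equations (the stationary distribution) of the charging-station process $(Q(t),Z(t))$ is given, for $0\le z\le q\le K$, by $$p_e(q,z)=p_Q(q)\,\frac{q!}{z!(q-z)!}\Big(\frac{\mu}{\nu+\mu}\Big)^{q-z}\Big(\frac{\nu}{\nu+\mu}\Big)^{z},$$ where $$p_Q(q):=\sum_{z=0}^{q}p_e(q,z)=\frac{1}{q!}\Big(\frac{\lambda}{\nu}\Big)^q p_Q(0).$$ Moreover, the probability of an empty system is $$p_e(0,0)=p_Q(0)=\Big(\sum_{i=0}^{K}\frac{1}{i!}\Big(\frac{\lambda}{\nu}\Big)^i\Big)^{-1}.$$
   Context: For $M=K$, the charging-station process $(Q(t),Z(t))_{t\ge 0}$ is the continuous-time Markov chain on $\{(q,z)\in\mathbb{Z}^2:0\le z\le q\le K\}$ with power allocation function $L(z)=z\wedge M=z$ and transitions: $(q,z)\to(q+1,z+1)$ at rate $\lambda$ if $q<K$; $(q,z)\to(q,z-1)$ at rate $\mu L(z)$; $(q,z)\to(q-1,z-1)$ at rate $\nu z$; $(q,z)\to(q-1,z)$ at rate $\nu(q-z)$. With $p(q,z)=\lim_{t\to\infty}\mathbb{P}(Q(t)=q,Z(t)=z)$, the balance equations are, for integers $0\le z\le q\le K$, $$\big(q\nu 1_{\{q>0\}}+\lambda 1_{\{q<K\}}+\mu L(z)1_{\{z>0\}}\big)p(q,z)=\lambda 1_{\{z>0\}}p(q-1,z-1)+(z+1)\nu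 1_{\{q<K\}}p(q+1,z+1)+\mu L(z+1)1_{\{q\ne z\}}p(q,z+1)+(q-z+1)\nu 1_{\{q<K\}}p(q+1,z),$$ together with the normalization $\sum_{q,z}p(q,z)=1$. *)

theory Defs
  imports "HOL-Probability.Probability"
begin

section \<open>Continuous-time Markov chains on a finite state space\<close>

text \<open>A standard transition function on the finite set \<open>S\<close>, with generator (Q-matrix) \<open>G\<close>:
  \<open>P t x y\<close> is the probability of going from \<open>x\<close> to \<open>y\<close> in time \<open>t\<close>, and the last clause is
  \<open>P h x y = of_bool (x = y) + G x y * h + o(h)\<close> as \<open>h\<close> decreases to \<open>0\<close>.\<close>

definition transition_function ::
  "'s set \<Rightarrow> ('s \<Rightarrow> 's \<Rightarrow> real) \<Rightarrow> (real \<Rightarrow> 's \<Rightarrow> 's \<Rightarrow> real) \<Rightarrow> bool" where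
  "transition_function S G P \<longleftrightarrow>
     (\<forall>t\<ge>0. \<forall>x\<in>S. (\<forall>y\<in>S. 0 \<le> P t x y) \<and> (\<Sum>y\<in>S. P t x y) = 1) \<and>
     (\<forall>x\<in>S. \<forall>y\<in>S. P 0 x y = of_bool (x = y)) \<and>
     (\<forall>s\<ge>0. \<forall>t\<ge>0. \<forall>x\<in>S. \<forall>y\<in>S. P (s + t) x y = (\<Sum>w\<in>S. P s x w * P t w y)) \<and>
     (\<forall>x\<in>S. \<forall>y\<in>S. ((\<lambda>t. P t x y) has_real_derivative G x y) (at_right 0))"

text \<open>The Markov property is stated without conditional probabilities, so that conditioning on
  events of probability zero does not arise. The initial distribution is arbitrary.\<close>

definition markov_chain ::
  "'w measure \<Rightarrow> (real \<Rightarrow> 'w \<Rightarrow> 's) \<Rightarrow> 's set \<Rightarrow> (real \<Rightarrow> 's \<Rightarrow> 's \<Rightarrow> real) \<Rightarrow> bool" where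
  "markov_chain N X S P \<longleftrightarrow>
     prob_space N \<and>
     (\<forall>t\<ge>0. X t \<in> measurable N (count_space S)) \<and>
     (\<forall>(n::nat) (ts::nat \<Rightarrow> real) (xs::nat \<Rightarrow> 's).
        0 \<le> ts 0 \<and> (\<forall>k\<le>n. ts k < ts (Suc k)) \<and> (\<forall>k\<le>Suc n. xs k \<in> S) \<longrightarrow>
        \<P>(\<omega> in N. \<forall>k\<le>Suc n. X (ts k) \<omega> = xs k) =
        \<P>(\<omega> in N. \<forall>k\<le>n. X (ts k) \<omega> = xs k) * P (ts (Suc n) - ts n) (xs n) (xs (Suc n)))"

definition ctmc ::
  "'w measure \<Rightarrow> (real \<Rightarrow> 'w \<Rightarrow> 's) \<Rightarrow> 's set \<Rightarrow> ('s \<Rightarrow> 's \<Rightarrow> real) \<Rightarrow> bool" where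
  "ctmc N X S G \<longleftrightarrow> (\<exists>P. transition_function S G P \<and> markov_chain N X S P)"

text \<open>The generator belonging to a family of jump rates; \<open>r x x\<close> is ignored.\<close>

definition generator :: "'s set \<Rightarrow> ('s \<Rightarrow> 's \<Rightarrow> real) \<Rightarrow> 's \<Rightarrow> 's \<Rightarrow> real" where
  "generator S r x y = (if x = y then - (\<Sum>w\<in>S - {x}. r x w) else r x y)"


section \<open>The charging station\<close>

text \<open>A state is a pair \<open>(q, z)\<close>: \<open>q\<close> vehicles are parked and \<open>z\<close> of them are not fully charged.
  All coordinates are nonnegative, so they are natural numbers.\<close>

definition states :: "nat \<Rightarrow> (nat \<times> nat) set" where
  "states K = {(q, z). z \<le> q \<and> q \<le> K}"

definition power_alloc :: "nat \<Rightarrow> nat \<Rightarrow> nat" where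
  "power_alloc M z = min z M"

text \<open>Downward jumps are written as \<open>q = q' + 1\<close> rather than \<open>q' = q - 1\<close>, avoiding truncated
  subtraction.\<close>

definition jump_rate ::
  "real \<Rightarrow> real \<Rightarrow> real \<Rightarrow> nat \<Rightarrow> nat \<Rightarrow> nat \<times> nat \<Rightarrow> nat \<times> nat \<Rightarrow> real" where
  "jump_rate lam mu nu K M = (\<lambda>(q, z) (q', z').
     if q < K \<and> q' = q + 1 \<and> z' = z + 1 then lam
     else if q' = q \<and> z = z' + 1 then mu * real (power_alloc M z)
     else if q = q' + 1 \<and> z = z' + 1 then nu * real z
     else if q = q' + 1 \<and> z' = z then nu * (real q - real z)
     else 0)"

definition charging_process ::
  "real \<Rightarrow> real \<Rightarrow> real \<Rightarrow> nat \<Rightarrow> nat \<Rightarrow> 'w measure \<Rightarrow>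
   (real \<Rightarrow> 'w \<Rightarrow> nat) \<Rightarrow> (real \<Rightarrow> 'w \<Rightarrow> nat) \<Rightarrow> bool" where
  "charging_process lam mu nu K M N Q Z \<longleftrightarrow>
     ctmc N (\<lambda>t \<omega>. (Q t \<omega>, Z t \<omega>)) (states K) (generator (states K) (jump_rate lam mu nu K M))"

text \<open>Every term that refers to \<open>p\<close> outside the state space, or in which a natural-number
  subtraction truncates, carries a vanishing indicator.\<close>

definition balance_equations ::
  "real \<Rightarrow> real \<Rightarrow> real \<Rightarrow> nat \<Rightarrow> nat \<Rightarrow> (nat \<Rightarrow> nat \<Rightarrow> real) \<Rightarrow> bool" where
  "balance_equations lam mu nu K M p \<longleftrightarrow>
     (\<forall>q z. z \<le> q \<and> q \<le> K \<longrightarrow>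
        (real q * nu * of_bool (q > 0) + lam * of_bool (q < K)
           + mu * real (power_alloc M z) * of_bool (z > 0)) * p q z =
        lam * of_bool (z > 0) * p (q - 1) (z - 1)
        + real (z + 1) * nu * of_bool (q < K) * p (q + 1) (z + 1)
        + mu * real (power_alloc M (z + 1)) * of_bool (q \<noteq> z) * p q (z + 1)
        + (real q - real z + 1) * nu * of_bool (q < K) * p (q + 1) z)"

definition normalized :: "nat \<Rightarrow> (nat \<Rightarrow> nat \<Rightarrow> real) \<Rightarrow> bool" where
  "normalized K p \<longleftrightarrow> (\<Sum>(q, z)\<in>states K. p q z) = 1"

definition marginal_Q :: "(nat \<Rightarrow> nat \<Rightarrow> real) \<Rightarrow> nat \<Rightarrow> real" where
  "marginal_Q p q = (\<Sum>z=0..q. p q z)"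

end

theory Submission
  imports Defs
begin

text \<open>
  For \<open>M = K\<close> the power constraint never binds, so vehicles do not interact except through the
  blocking of arrivals at a full station: an uncharged vehicle becomes charged at rate \<open>mu\<close> and
  every vehicle leaves at rate \<open>nu\<close>. The uncharged and the charged vehicles are thus a tandem of
  two infinite-server queues. With unlimited space their numbers would be independent Poisson
  variables in equilibrium, with means \<open>a = lam / (nu + mu)\<close> and \<open>b = (lam / nu) * mu / (nu + mu)\<close>,
  and blocking only truncates this law to \<open>q \<le> K\<close>. Hence the candidate is
  \<open>c * (a ^ z / fact z) * (b ^ (q - z) / fact (q - z))\<close>. Its balance equations
  (\<open>balance_equations_poisson_weights\<close>) come down to the ratios of neighbouring weights. As
  \<open>a + b = lam / nu\<close>, the binomial theorem gives the truncated Poisson law for \<open>q\<close> and, given \<open>q\<close>,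
  the binomial law for \<open>z\<close>.

  The candidate is the only normalized solution, also among signed ones (\<open>stationary_unique\<close>): by
  balance, the ratio of any solution to the positive candidate is at each state a weighted average of
  its values at the states that jump there. A maximum of the ratio therefore spreads backwards along
  jumps, and by irreducibility the ratio is constant.

  That the time-\<open>t\<close> law tends to this solution holds for every irreducible finite chain
  (\<open>ctmc_tendsto_stationary\<close>): a stationary vector is invariant under the transition function
  (\<open>evolve_stationary\<close>), at some time \<open>T\<close> all transition probabilities are positive
  (\<open>transition_positive\<close>), and so the difference of two laws loses a fixed fraction of its
  variation in every period of length \<open>T\<close> (\<open>variation_evolve_tendsto_0\<close>).
\<close>

section \<open>Signed measures under a transition function\<close>

definition evolve :: "'s set \<Rightarrow> (real \<Rightarrow> 's \<Rightarrow> 's \<Rightarrow> real) \<Rightarrow> real \<Rightarrow> ('s \<Rightarrow> real) \<Rightarrow> 's \<Rightarrow> real" where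
  "evolve S P t v y = (\<Sum>x\<in>S. v x * P t x y)"

definition variation :: "'s set \<Rightarrow> ('s \<Rightarrow> real) \<Rightarrow> real" where
  "variation S v = (\<Sum>x\<in>S. \<bar>v x\<bar>)"

text \<open>The equation \<open>v G = 0\<close> for a row vector. Signs are unrestricted, because a solution of the
  balance equations need not be known to be nonnegative.\<close>

definition stationary :: "'s set \<Rightarrow> ('s \<Rightarrow> 's \<Rightarrow> real) \<Rightarrow> ('s \<Rightarrow> real) \<Rightarrow> bool" where
  "stationary S G v \<longleftrightarrow> (\<forall>y\<in>S. (\<Sum>x\<in>S. v x * G x y) = 0)"

definition jumps :: "'s set \<Rightarrow> ('s \<Rightarrow> 's \<Rightarrow> real) \<Rightarrow> ('s \<times> 's) set" where
  "jumps S G = {(x, y). x \<in> S \<and> y \<in> S \<and> x \<noteq> y \<and> 0 < G x y}"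

definition irreducible_on :: "'s set \<Rightarrow> ('s \<Rightarrow> 's \<Rightarrow> real) \<Rightarrow> bool" where
  "irreducible_on S G \<longleftrightarrow> (\<forall>x\<in>S. \<forall>y\<in>S. (x, y) \<in> (jumps S G)\<^sup>*)"

lemma evolve_diff: "evolve S P t (\<lambda>x. v x - w x) y = evolve S P t v y - evolve S P t w y"
  by (simp add: evolve_def left_diff_distrib sum_subtractf)

lemma variation_nonneg: "0 \<le> variation S v"
  by (simp add: variation_def sum_nonneg)

lemma variation_cong: "(\<And>x. x \<in> S \<Longrightarrow> v x = w x) \<Longrightarrow> variation S v = variation S w"
  by (simp add: variation_def)

lemma abs_le_variation: "finite S \<Longrightarrow> x \<in> S \<Longrightarrow> \<bar>v x\<bar> \<le> variation S v"
  unfolding variation_def by (rule member_le_sum) auto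

text \<open>Doeblin's estimate. If \<open>d\<close> or the total mass of \<open>v\<close> vanishes, subtracting \<open>d\<close> from every entry
  of the transition matrix does not change the image of \<open>v\<close>, but it lowers every row sum by
  \<open>d\<close> times the number of states. The case \<open>d = 0\<close> is plain contractivity.\<close>

lemma variation_evolve_le_minorised:
  assumes "finite S" and "\<And>x y. x \<in> S \<Longrightarrow> y \<in> S \<Longrightarrow> d \<le> P t x y"
    and row: "\<And>x. x \<in> S \<Longrightarrow> (\<Sum>y\<in>S. P t x y) = 1"
    and mass: "d * (\<Sum>x\<in>S. v x) = 0"
  shows "variation S (evolve S P t v) \<le> (1 - real (card S) * d) * variation S v"
proof -
  have "evolve S P t v y = (\<Sum>x\<in>S. v x * (P t x y - d))" for y
    using mass by (simp add: evolve_def right_diff_distrib sum_subtractf mult.commute[of _ d]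
        flip: sum_distrib_left)
  then have "variation S (evolve S P t v) \<le> (\<Sum>y\<in>S. \<Sum>x\<in>S. \<bar>v x * (P t x y - d)\<bar>)"
    unfolding variation_def by (auto intro!: sum_mono)
  also have "\<dots> = (\<Sum>y\<in>S. \<Sum>x\<in>S. \<bar>v x\<bar> * (P t x y - d))"
    using assms(2) by (auto intro!: sum.cong simp: abs_mult)
  also have "\<dots> = (\<Sum>x\<in>S. \<bar>v x\<bar> * (\<Sum>y\<in>S. P t x y - d))"
    by (subst sum.swap) (simp add: sum_distrib_left)
  also have "\<dots> = (1 - real (card S) * d) * variation S v"
    by (simp add: sum_subtractf row variation_def mult.commute[of _ "1 - _"] flip: sum_distrib_left)
  finally show ?thesis .
qed

context
  fixes S :: "'s set" and G :: "'s \<Rightarrow> 's \<Rightarrow> real" and P :: "real \<Rightarrow> 's \<Rightarrow> 's \<Rightarrow> real"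
  assumes fin: "finite S" and tf: "transition_function S G P"
begin

lemma transition_nonneg: "0 \<le> t \<Longrightarrow> x \<in> S \<Longrightarrow> y \<in> S \<Longrightarrow> 0 \<le> P t x y"
  and transition_row: "0 \<le> t \<Longrightarrow> x \<in> S \<Longrightarrow> (\<Sum>y\<in>S. P t x y) = 1"
  and transition_zero: "x \<in> S \<Longrightarrow> y \<in> S \<Longrightarrow> P 0 x y = of_bool (x = y)"
  and transition_add: "0 \<le> s \<Longrightarrow> 0 \<le> t \<Longrightarrow> x \<in> S \<Longrightarrow> y \<in> S \<Longrightarrow>
    P (s + t) x y = (\<Sum>w\<in>S. P s x w * P t w y)"
  and transition_deriv: "x \<in> S \<Longrightarrow> y \<in> S \<Longrightarrow>
    ((\<lambda>t. P t x y) has_real_derivative G x y) (at_right 0)"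
  using tf unfolding transition_function_def by blast+

lemma transition_quotient:
  assumes "x \<in> S" "y \<in> S"
  shows "((\<lambda>h. (P h x y - of_bool (x = y)) / h) \<longlongrightarrow> G x y) (at_right 0)"
  using transition_deriv[OF assms] assms
  by (simp add: has_field_derivative_iff transition_zero)

lemma evolve_zero: "y \<in> S \<Longrightarrow> evolve S P 0 v y = v y"
  using fin by (simp add: evolve_def transition_zero if_distrib cong: if_cong)

lemma evolve_add:
  assumes "0 \<le> s" "0 \<le> t" "y \<in> S"
  shows "evolve S P (s + t) v y = evolve S P t (evolve S P s v) y"
proof -
  have "evolve S P (s + t) v y = (\<Sum>x\<in>S. \<Sum>w\<in>S. v x * P s x w * P t w y)"
    using assms by (simp add: evolve_def transition_add sum_distrib_left mult.assoc)
  also have "\<dots> = evolve S P t (evolve S P s v) y"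
    by (subst sum.swap) (simp add: evolve_def sum_distrib_right)
  finally show ?thesis .
qed

lemma sum_evolve: "0 \<le> t \<Longrightarrow> (\<Sum>y\<in>S. evolve S P t v y) = (\<Sum>x\<in>S. v x)"
  unfolding evolve_def by (subst sum.swap) (simp add: transition_row flip: sum_distrib_left)

lemma variation_evolve_le: "0 \<le> t \<Longrightarrow> variation S (evolve S P t v) \<le> variation S v"
  using variation_evolve_le_minorised[of S 0 P t v] fin transition_nonneg transition_row by simp

text \<open>Differentiating \<open>v P(t)\<close> would need two-sided derivatives, but the transition function
  is only known to have right derivatives at \<open>0\<close>. Instead, let \<open>e t\<close> be the
  variation of \<open>v P(t) - v\<close>. By contractivity it is subadditive, so \<open>e t \<le> n e (t / n)\<close>, and \<open>v G = 0\<close>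
  says that \<open>e h = o(h)\<close>.\<close>

lemma evolve_stationary:
  assumes st: "stationary S G v" and "0 \<le> t" "y \<in> S"
  shows "evolve S P t v y = v y"
proof -
  define e where "e t = variation S (\<lambda>y. evolve S P t v y - v y)" for t
  have subadd: "e (s + t) \<le> e s + e t" if "0 \<le> s" "0 \<le> t" for s t
  proof -
    have "e (s + t) = variation S (\<lambda>y. evolve S P t (\<lambda>x. evolve S P s v x - v x) y
        + (evolve S P t v y - v y))"
      unfolding e_def using that
      by (intro variation_cong) (simp add: evolve_add evolve_diff)
    also have "\<dots> \<le> variation S (evolve S P t (\<lambda>x. evolve S P s v x - v x)) + e t"
      unfolding variation_def e_def sum.distrib[symmetric] by (intro sum_mono abs_triangle_ineq)
    also have "\<dots> \<le> e s + e t"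
      using variation_evolve_le[OF that(2)] by (simp add: e_def)
    finally show ?thesis .
  qed
  have e0: "e 0 = 0" by (simp add: e_def variation_def evolve_zero)
  have mult: "e (real n * h) \<le> real n * e h" if "0 \<le> h" for n h
  proof (induction n)
    case (Suc n)
    then show ?case using subadd[of "real n * h" h] that by (simp add: algebra_simps)
  qed (simp add: e0)
  have quot: "((\<lambda>h. e h / h) \<longlongrightarrow> 0) (at_right 0)"
  proof -
    have lim: "((\<lambda>h. (evolve S P h v y - v y) / h) \<longlongrightarrow> 0) (at_right 0)" if y: "y \<in> S" for y
    proof -
      have "((\<lambda>h. \<Sum>x\<in>S. v x * ((P h x y - of_bool (x = y)) / h))
          \<longlongrightarrow> (\<Sum>x\<in>S. v x * G x y)) (at_right 0)"
        using y by (intro tendsto_intros transition_quotient)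
      moreover have "(\<Sum>x\<in>S. v x * ((P h x y - of_bool (x = y)) / h))
          = (evolve S P h v y - v y) / h" for h
      proof -
        have "v y = (\<Sum>x\<in>S. v x * of_bool (x = y))"
          using y fin by (simp add: if_distrib cong: if_cong)
        then show ?thesis
          by (simp add: evolve_def right_diff_distrib flip: sum_divide_distrib sum_subtractf)
      qed
      ultimately show ?thesis using st y by (simp add: stationary_def)
    qed
    have "((\<lambda>h. \<Sum>y\<in>S. \<bar>(evolve S P h v y - v y) / h\<bar>) \<longlongrightarrow> (\<Sum>y\<in>S. 0)) (at_right 0)"
      by (intro tendsto_sum tendsto_rabs_zero lim)
    then have "((\<lambda>h. \<Sum>y\<in>S. \<bar>(evolve S P h v y - v y) / h\<bar>) \<longlongrightarrow> 0) (at_right 0)" by simp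
    then show ?thesis
      by (rule Lim_transform_eventually)
        (auto simp: eventually_at_filter e_def variation_def sum_divide_distrib)
  qed
  have "e t = 0"
  proof (cases "t = 0")
    case False
    with assms(2) have t: "0 < t" by simp
    have "filterlim (\<lambda>n. t / real (Suc n)) (at_right 0) sequentially"
      unfolding filterlim_at using t filterlim_compose[OF filterlim_real_sequentially filterlim_Suc]
      by (auto intro!: tendsto_divide_0[OF tendsto_const] filterlim_at_top_imp_at_infinity
          simp del: of_nat_Suc)
    from filterlim_compose[OF quot this]
    have "(\<lambda>n. t * (e (t / real (Suc n)) / (t / real (Suc n)))) \<longlonglongrightarrow> t * 0"
      by (intro tendsto_intros)
    moreover have "e t \<le> t * (e (t / real (Suc n)) / (t / real (Suc n)))" for n
      using mult[of "t / real (Suc n)" "Suc n"] t by (simp add: field_simps del: of_nat_Suc)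
    ultimately have "e t \<le> 0" by (intro LIMSEQ_le_const) auto
    then show ?thesis using variation_nonneg[of S] by (simp add: e_def order_antisym)
  qed (simp add: e0)
  then show ?thesis
    using abs_le_variation[OF fin \<open>y \<in> S\<close>, of "\<lambda>y. evolve S P t v y - v y"] by (simp add: e_def)
qed

text \<open>For one small enough \<open>h\<close>, staying put and every single jump of positive rate have
  positive probability in time \<open>h\<close>. A path of \<open>n\<close> jumps then has positive probability in time
  \<open>m h\<close> for all \<open>m \<ge> n\<close>, since waiting steps can be added; so one multiple of \<open>h\<close> serves all pairs.\<close>

lemma transition_positive:
  assumes irr: "irreducible_on S G"
  obtains T where "0 < T" "\<And>x y. x \<in> S \<Longrightarrow> y \<in> S \<Longrightarrow> 0 < P T x y"
proof -
  have diag: "\<forall>\<^sub>F h in at_right 0. 0 < P h x x" if "x \<in> S" for x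
  proof -
    have "((\<lambda>h. P h x x) \<longlongrightarrow> P 0 x x) (at_right 0)"
      using DERIV_continuous[OF transition_deriv[OF that that]] by (simp add: continuous_within)
    then show ?thesis
      using that by (intro order_tendstoD) (auto simp: transition_zero)
  qed
  have off: "\<forall>\<^sub>F h in at_right 0. 0 < P h x y" if "(x, y) \<in> jumps S G" for x y
  proof -
    from that have xy: "x \<in> S" "y \<in> S" "x \<noteq> y" "0 < G x y" by (auto simp: jumps_def)
    have "\<forall>\<^sub>F h in at_right 0. 0 < P h x y / h"
      using order_tendstoD(1)[OF transition_quotient[OF xy(1,2)] xy(4)] xy(3) by simp
    then show ?thesis
      using eventually_at_right_less by eventually_elim (simp add: zero_less_divide_iff)
  qed
  have "\<forall>\<^sub>F h in at_right 0. 0 < h \<and>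
      (\<forall>x\<in>S. \<forall>y\<in>S. x = y \<or> (x, y) \<in> jumps S G \<longrightarrow> 0 < P h x y)"
  proof (intro eventually_conj eventually_at_right_less eventually_ball_finite fin ballI)
    fix x y assume "x \<in> S" "y \<in> S"
    show "\<forall>\<^sub>F h in at_right 0. x = y \<or> (x, y) \<in> jumps S G \<longrightarrow> 0 < P h x y"
    proof (cases "x = y \<or> (x, y) \<in> jumps S G")
      case True
      then have "\<forall>\<^sub>F h in at_right 0. 0 < P h x y" using diag[OF \<open>x \<in> S\<close>] off by blast
      then show ?thesis by (rule eventually_mono) simp
    qed simp
  qed
  then obtain h where h: "0 < h"
    and pos: "\<And>x y. x \<in> S \<Longrightarrow> y \<in> S \<Longrightarrow> x = y \<or> (x, y) \<in> jumps S G \<Longrightarrow> 0 < P h x y"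
    using eventually_happens'[OF trivial_limit_at_right_real] by blast
  have extend: "0 < P (real (Suc m) * h) x z"
    if "0 < P (real m * h) x y" "0 < P h y z" "x \<in> S" "y \<in> S" "z \<in> S" for m x y z
  proof -
    have "0 < (\<Sum>w\<in>S. P (real m * h) x w * P h w z)"
      using that h fin by (intro sum_pos2[of _ y]) (auto simp: transition_nonneg)
    then show ?thesis using transition_add[of "real m * h" h x z] h that by (simp add: algebra_simps)
  qed
  have reach: "\<forall>\<^sub>F m in sequentially. 0 < P (real m * h) x y" if "x \<in> S" "y \<in> S" for x y
  proof -
    have "(x, y) \<in> (jumps S G)\<^sup>*" using irr that by (auto simp: irreducible_on_def)
    then show ?thesis
    proof (induction rule: rtrancl_induct)
      case base
      have "0 < P (real m * h) x x" for m
        by (induction m) (use that pos extend in \<open>auto simp: transition_zero simp del: of_nat_Suc\<close>)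
      then show ?case by simp
    next
      case (step y z)
      then have yz: "y \<in> S" "z \<in> S" by (auto simp: jumps_def)
      with step.hyps pos have "0 < P h y z" by blast
      with step.IH have "\<forall>\<^sub>F m in sequentially. 0 < P (real (Suc m) * h) x z"
        by (elim eventually_mono) (use extend yz that in blast)
      then show ?case by (subst (asm) eventually_sequentially_Suc)
    qed
  qed
  have "\<forall>\<^sub>F m in sequentially. 0 < m \<and> (\<forall>x\<in>S. \<forall>y\<in>S. 0 < P (real m * h) x y)"
    by (intro eventually_conj eventually_gt_at_top eventually_ball_finite fin ballI reach)
  then obtain m where "0 < m" "\<forall>x\<in>S. \<forall>y\<in>S. 0 < P (real m * h) x y"
    using eventually_happens'[OF sequentially_bot] by blast
  with h show thesis by (intro that[of "real m * h"]) auto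
qed

text \<open>The variation is nonincreasing in time and shrinks by a constant factor below \<open>1\<close> over
  each period in which all transition probabilities are positive.\<close>

lemma variation_evolve_tendsto_0:
  assumes irr: "irreducible_on S G" and mass: "(\<Sum>x\<in>S. v x) = 0"
  shows "((\<lambda>t. variation S (evolve S P t v)) \<longlongrightarrow> 0) at_top"
proof (cases "S = {}")
  case False
  define D where "D t = variation S (evolve S P t v)" for t
  obtain T where T: "0 < T" and pos: "\<And>x y. x \<in> S \<Longrightarrow> y \<in> S \<Longrightarrow> 0 < P T x y"
    using transition_positive[OF irr] by blast
  define d where "d = Min ((\<lambda>(x, y). P T x y) ` (S \<times> S))"
  have d_le: "d \<le> P T x y" if "x \<in> S" "y \<in> S" for x y
    unfolding d_def using that fin by (intro Min_le) auto
  have "d \<in> (\<lambda>(x, y). P T x y) ` (S \<times> S)"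
    unfolding d_def using fin False by (intro Min_in) auto
  then have d: "0 < d" using pos by auto
  define c where "c = 1 - real (card S) * d"
  have "c < 1" using d fin False by (simp add: c_def card_gt_0_iff)
  obtain x where x: "x \<in> S" using False by blast
  \<comment> \<open>The contraction factor is nonnegative because \<open>d\<close> is at most the average of a row.\<close>
  have "real (card S) * d \<le> (\<Sum>y\<in>S. P T x y)"
    using sum_bounded_below[of S d "P T x"] d_le[OF x] by simp
  then have "0 \<le> c" using transition_row[of T x] T x by (simp add: c_def)
  have contr: "D (s + T) \<le> c * D s" if "0 \<le> s" for s
  proof -
    have "D (s + T) = variation S (evolve S P T (evolve S P s v))"
      unfolding D_def using that T by (intro variation_cong evolve_add) auto
    also have "\<dots> \<le> c * D s"
      unfolding c_def D_def using T that d_le mass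
      by (intro variation_evolve_le_minorised fin) (auto simp: transition_row sum_evolve)
    finally show ?thesis .
  qed
  have pow: "D (real n * T) \<le> c ^ n * D 0" for n
  proof (induction n)
    case (Suc n)
    have "D (real (Suc n) * T) \<le> c * D (real n * T)"
      using contr[of "real n * T"] T by (simp add: algebra_simps)
    also have "\<dots> \<le> c * (c ^ n * D 0)" using Suc \<open>0 \<le> c\<close> by (intro mult_left_mono)
    finally show ?case by simp
  qed simp
  have anti: "D t \<le> D s" if "0 \<le> s" "s \<le> t" for s t
  proof -
    have "D t = variation S (evolve S P (t - s) (evolve S P s v))"
      unfolding D_def using that evolve_add[of s "t - s" _ v] by (intro variation_cong) simp
    also have "\<dots> \<le> D s" unfolding D_def using that by (intro variation_evolve_le) simp
    finally show ?thesis .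
  qed
  have "(\<lambda>n. c ^ n * D 0) \<longlonglongrightarrow> 0"
    using \<open>0 \<le> c\<close> \<open>c < 1\<close> by (intro tendsto_mult_left_zero LIMSEQ_power_zero) auto
  show ?thesis
    unfolding D_def[symmetric]
  proof (rule order_tendstoI)
    fix a :: real assume "0 < a"
    from order_tendstoD(2)[OF \<open>(\<lambda>n. c ^ n * D 0) \<longlonglongrightarrow> 0\<close> this]
    obtain n where "c ^ n * D 0 < a" using eventually_happens'[OF sequentially_bot] by blast
    then have "D (real n * T) < a" using pow[of n] by simp
    show "\<forall>\<^sub>F t in at_top. D t < a"
      using eventually_ge_at_top[of "real n * T"]
    proof eventually_elim
      case (elim t)
      then show ?case using anti[of "real n * T" t] T \<open>D (real n * T) < a\<close> by simp
    qed
  next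
    fix a :: real assume "a < 0"
    then show "\<forall>\<^sub>F t in at_top. a < D t"
      by (auto simp: D_def intro!: always_eventually less_le_trans[OF _ variation_nonneg])
  qed
qed (simp add: variation_def)

lemma evolve_tendsto_stationary:
  assumes irr: "irreducible_on S G" and st: "stationary S G p"
    and mass: "(\<Sum>x\<in>S. v x) = (\<Sum>x\<in>S. p x)" and y: "y \<in> S"
  shows "((\<lambda>t. evolve S P t v y) \<longlongrightarrow> p y) at_top"
proof -
  have "((\<lambda>t. variation S (evolve S P t (\<lambda>x. v x - p x))) \<longlongrightarrow> 0) at_top"
    using mass by (intro variation_evolve_tendsto_0 irr) (simp add: sum_subtractf)
  moreover have "\<forall>\<^sub>F t in at_top. norm (evolve S P t v y - p y)
      \<le> variation S (evolve S P t (\<lambda>x. v x - p x))"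
    using eventually_ge_at_top[of 0]
  proof eventually_elim
    case (elim t)
    then show ?case
      using abs_le_variation[OF fin y, of "evolve S P t (\<lambda>x. v x - p x)"]
        evolve_stationary[OF st elim y] by (simp add: evolve_diff)
  qed
  ultimately have "((\<lambda>t. evolve S P t v y - p y) \<longlongrightarrow> 0) at_top"
    by (rule Lim_null_comparison[rotated])
  then show ?thesis by (simp add: LIM_zero_iff)
qed

end

section \<open>Finite Markov chains\<close>

lemma markov_chain_prob_space: "markov_chain N X S P \<Longrightarrow> prob_space N"
  unfolding markov_chain_def by (rule conjunct1)

lemma markov_chain_measurable:
  assumes "markov_chain N X S P" and "0 \<le> t"
  shows "X t \<in> measurable N (count_space S)"
  using assms(1)[unfolded markov_chain_def, THEN conjunct2, THEN conjunct1] assms(2) by blast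

lemma markov_chain_event:
  assumes "markov_chain N X S P" and "0 \<le> t" and "x \<in> S"
  shows "{\<omega> \<in> space N. X t \<omega> = x} \<in> sets N"
proof -
  have "X t \<in> measurable N (count_space S)"
    using assms by (intro markov_chain_measurable)
  then have "X t -` {x} \<inter> space N \<in> sets N"
    using assms(3) by (intro measurable_sets) auto
  moreover have "X t -` {x} \<inter> space N = {\<omega> \<in> space N. X t \<omega> = x}" by auto
  ultimately show ?thesis by simp
qed

lemma markov_chain_range:
  assumes "markov_chain N X S P" and "0 \<le> t" and "\<omega> \<in> space N"
  shows "X t \<omega> \<in> S"
proof -
  have "X t \<in> measurable N (count_space S)"
    using assms by (intro markov_chain_measurable)
  from measurable_space[OF this assms(3)] show ?thesis by (simp only: space_count_space)
qed

text \<open>The instance of the Markov property with the two times \<open>0\<close> and \<open>t\<close>, summed over the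
  initial state.\<close>

lemma markov_chain_marginal:
  assumes fin: "finite S" and mc: "markov_chain N X S P" and t: "0 < t" and y: "y \<in> S"
  shows "\<P>(\<omega> in N. X t \<omega> = y) = evolve S P t (\<lambda>x. \<P>(\<omega> in N. X 0 \<omega> = x)) y"
proof -
  interpret prob_space N using mc by (rule markov_chain_prob_space)
  have joint: "\<P>(\<omega> in N. X 0 \<omega> = x \<and> X t \<omega> = y) = \<P>(\<omega> in N. X 0 \<omega> = x) * P t x y"
    if "x \<in> S" for x
  proof -
    define ts where "ts k = (if k = 0 then 0 else t)" for k :: nat
    define xs where "xs k = (if k = 0 then x else y)" for k :: nat
    have [simp]: "ts 0 = 0" "ts (Suc k) = t" "xs 0 = x" "xs (Suc k) = y" for k
      by (simp_all add: ts_def xs_def)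
    have upto: "(\<forall>k\<le>0. R k) \<longleftrightarrow> R 0" "(\<forall>k\<le>Suc 0. R k) \<longleftrightarrow> R 0 \<and> R (Suc 0)"
      for R :: "nat \<Rightarrow> bool"
      by (auto simp: le_Suc_eq)
    have "0 \<le> ts 0 \<and> (\<forall>k\<le>0. ts k < ts (Suc k)) \<and> (\<forall>k\<le>Suc 0. xs k \<in> S)"
      using t y that by (simp add: upto)
    then have "\<P>(\<omega> in N. \<forall>k\<le>Suc 0. X (ts k) \<omega> = xs k) =
        \<P>(\<omega> in N. \<forall>k\<le>0. X (ts k) \<omega> = xs k) * P (ts (Suc 0) - ts 0) (xs 0) (xs (Suc 0))"
      by (rule mc[unfolded markov_chain_def, THEN conjunct2, THEN conjunct2,
            THEN spec[of _ 0], THEN spec[of _ ts], THEN spec[of _ xs], THEN mp])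
    then show ?thesis by (simp add: upto)
  qed
  have "{\<omega> \<in> space N. X t \<omega> = y} = (\<Union>x\<in>S. {\<omega> \<in> space N. X 0 \<omega> = x \<and> X t \<omega> = y})"
    using markov_chain_range[OF mc order_refl] by blast
  moreover have "prob (\<Union>x\<in>S. {\<omega> \<in> space N. X 0 \<omega> = x \<and> X t \<omega> = y})
      = (\<Sum>x\<in>S. \<P>(\<omega> in N. X 0 \<omega> = x \<and> X t \<omega> = y))"
  proof (rule finite_measure_finite_Union[OF fin])
    show "(\<lambda>x. {\<omega> \<in> space N. X 0 \<omega> = x \<and> X t \<omega> = y}) ` S \<subseteq> sets N"
      using markov_chain_event[OF mc] t y by (intro image_subsetI sets.sets_Collect_conj) auto
    show "disjoint_family_on (\<lambda>x. {\<omega> \<in> space N. X 0 \<omega> = x \<and> X t \<omega> = y}) S"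
      unfolding disjoint_family_on_def by blast
  qed
  ultimately have "\<P>(\<omega> in N. X t \<omega> = y) = (\<Sum>x\<in>S. \<P>(\<omega> in N. X 0 \<omega> = x \<and> X t \<omega> = y))"
    by (simp only:)
  then show ?thesis by (simp add: joint evolve_def)
qed

text \<open>The law at time \<open>t > 0\<close> is the initial law evolved for time \<open>t\<close>, and the initial law has the
  same mass as \<open>p\<close>.\<close>

theorem ctmc_tendsto_stationary:
  assumes fin: "finite S" and irr: "irreducible_on S G" and st: "stationary S G p"
    and mass: "(\<Sum>x\<in>S. p x) = 1" and mc: "ctmc N X S G" and y: "y \<in> S"
  shows "((\<lambda>t. \<P>(\<omega> in N. X t \<omega> = y)) \<longlongrightarrow> p y) at_top"
proof -
  from mc obtain P where tf: "transition_function S G P" and P: "markov_chain N X S P"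
    by (auto simp: ctmc_def)
  interpret prob_space N using P by (rule markov_chain_prob_space)
  define v where "v x = \<P>(\<omega> in N. X 0 \<omega> = x)" for x
  have "space N = (\<Union>x\<in>S. {\<omega> \<in> space N. X 0 \<omega> = x})"
    using markov_chain_range[OF P order_refl] by auto
  then have "(\<Sum>x\<in>S. v x) = prob (space N)"
    unfolding v_def using fin markov_chain_event[OF P]
    by (subst finite_measure_finite_Union[symmetric]) (auto simp: disjoint_family_on_def)
  then have "(\<Sum>x\<in>S. v x) = (\<Sum>x\<in>S. p x)" using mass by (simp add: prob_space)
  then have "((\<lambda>t. evolve S P t v y) \<longlongrightarrow> p y) at_top"
    by (rule evolve_tendsto_stationary[OF fin tf irr st _ y])
  moreover have "\<forall>\<^sub>F t in at_top. evolve S P t v y = \<P>(\<omega> in N. X t \<omega> = y)"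
    using eventually_gt_at_top[of 0]
    by (rule eventually_mono) (simp add: markov_chain_marginal[OF fin P _ y] v_def[abs_def])
  ultimately show ?thesis by (rule Lim_transform_eventually)
qed

text \<open>A maximum principle for \<open>u = v / p\<close>. At a maximum \<open>b\<close> of \<open>u\<close>, stationarity of \<open>v\<close> and of
  \<open>p\<close> makes the sum of the nonnegative terms \<open>p x (u b - u x) G x b\<close> vanish, so \<open>u\<close> takes its maximum
  at every state that can jump to \<open>b\<close> as well.\<close>

theorem stationary_unique:
  assumes fin: "finite S" and irr: "irreducible_on S G"
    and nonneg: "\<And>x y. x \<in> S \<Longrightarrow> y \<in> S \<Longrightarrow> x \<noteq> y \<Longrightarrow> 0 \<le> G x y"
    and p: "stationary S G p" "\<And>x. x \<in> S \<Longrightarrow> 0 < p x" "(\<Sum>x\<in>S. p x) = 1"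
    and v: "stationary S G v" "(\<Sum>x\<in>S. v x) = 1"
    and x: "x \<in> S"
  shows "v x = p x"
proof -
  define u where "u x = v x / p x" for x
  have vu: "v x = p x * u x" if "x \<in> S" for x using p(2)[OF that] by (simp add: u_def)
  have "Max (u ` S) \<in> u ` S" using fin x by (intro Max_in) auto
  then obtain y where "y \<in> S" "u y = Max (u ` S)" by force
  then have y: "y \<in> S" "\<And>x. x \<in> S \<Longrightarrow> u x \<le> u y" using fin by auto
  have const: "u z = u y" if "z \<in> S" for z
  proof -
    have "(z, y) \<in> (jumps S G)\<^sup>*" using irr that y(1) by (auto simp: irreducible_on_def)
    then show ?thesis
    proof (induction rule: converse_rtrancl_induct)
      case (step a b)
      then have ab: "a \<in> S" "b \<in> S" "a \<noteq> b" "0 < G a b" by (auto simp: jumps_def)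
      have "(\<Sum>x\<in>S. p x * (u b - u x) * G x b) = u b * (\<Sum>x\<in>S. p x * G x b) - (\<Sum>x\<in>S. v x * G x b)"
        by (simp add: vu algebra_simps sum_subtractf sum_distrib_left)
      also have "\<dots> = 0" using p(1) v(1) ab by (simp add: stationary_def)
      finally have "(\<Sum>x\<in>S. p x * (u b - u x) * G x b) = 0" .
      moreover have "0 \<le> p x * (u b - u x) * G x b" if "x \<in> S" for x
        using that y(2)[OF that] p(2)[OF that] nonneg[OF that ab(2)] step.IH
        by (cases "x = b") auto
      ultimately have "p a * (u b - u a) * G a b = 0"
        using fin ab(1) by (simp add: sum_nonneg_eq_0_iff)
      then show ?case using ab p(2)[OF ab(1)] step.IH by simp
    qed simp
  qed
  have "1 = (\<Sum>x\<in>S. p x * u y)" using v(2) vu const by simp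
  also have "\<dots> = u y" using p(3) by (simp flip: sum_distrib_right)
  finally have "u x = 1" using const[OF x] by simp
  then show ?thesis using vu[OF x] by simp
qed

section \<open>The generator of the charging station\<close>

lemma mem_states: "(q, z) \<in> states K \<longleftrightarrow> z \<le> q \<and> q \<le> K"
  by (simp add: states_def)

lemma finite_states: "finite (states K)"
  by (rule finite_subset[of _ "{..K} \<times> {..K}"]) (auto simp: states_def)

lemma jump_rate_self: "jump_rate lam mu nu K M x x = 0"
  by (cases x) (simp add: jump_rate_def)

lemma jump_rate_nonneg:
  "0 \<le> lam \<Longrightarrow> 0 \<le> mu \<Longrightarrow> 0 \<le> nu \<Longrightarrow> x \<in> states K \<Longrightarrow> 0 \<le> jump_rate lam mu nu K M x y"
  by (cases x; cases y) (auto simp: jump_rate_def states_def)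

lemma jump_rate_full_power:
  assumes "z \<le> K"
  shows "jump_rate lam mu nu K K (q, z) (q', z') =
    (if q < K \<and> q' = q + 1 \<and> z' = z + 1 then lam
     else if q' = q \<and> z = z' + 1 then mu * real z
     else if q = q' + 1 \<and> z = z' + 1 then nu * real z
     else if q = q' + 1 \<and> z' = z then nu * (real q - real z)
     else 0)"
  using assms by (simp only: jump_rate_def prod.case power_alloc_def min_absorb1)

lemma generator_off_diagonal: "x \<noteq> y \<Longrightarrow> generator S r x y = r x y"
  by (simp add: generator_def)

text \<open>A departure target such as \<open>(q - 1, z)\<close> may be truncated or lie outside the state space; its
  rate is then \<open>0\<close>, so that the total departure rate is always \<open>nu * q\<close>.\<close>

lemma total_jump_rate:
  assumes "z \<le> q" "q \<le> K"
  shows "(\<Sum>w\<in>states K. jump_rate lam mu nu K K (q, z) w)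
    = lam * of_bool (q < K) + mu * real z + nu * real q"
proof -
  have rate: "jump_rate lam mu nu K K (q, z) w =
      (if w = (q + 1, z + 1) then lam * of_bool (q < K) else 0)
      + (if w = (q, z - 1) then mu * real z else 0)
      + (if w = (q - 1, z - 1) then nu * real z else 0)
      + (if w = (q - 1, z) then nu * (real q - real z) else 0)" for w
  proof -
    obtain q' z' where w: "w = (q', z')" by (cases w)
    have "z \<le> K" using assms by simp
    show ?thesis
      unfolding w jump_rate_full_power[OF \<open>z \<le> K\<close>] using assms by (cases z; cases q) simp_all
  qed
  have targets: "(q + 1, z + 1) \<in> states K \<longleftrightarrow> q < K"
    "(q, z - 1) \<in> states K" "(q - 1, z - 1) \<in> states K"
    "(q - 1, z) \<in> states K \<longleftrightarrow> z < q \<or> q = 0"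
    using assms by (auto simp: mem_states)
  have "(\<Sum>w\<in>states K. jump_rate lam mu nu K K (q, z) w) =
      lam * of_bool (q < K) + mu * real z + nu * real z + nu * (real q - real z)"
    unfolding rate sum.distrib sum.delta[OF finite_states] targets
    using assms targets(2,3) by (cases "z < q") simp_all
  then show ?thesis by (simp add: right_diff_distrib)
qed

lemma inflow:
  assumes "z \<le> q" "q \<le> K"
  shows "(\<Sum>x\<in>states K. v x * jump_rate lam mu nu K K x (q, z)) =
    lam * of_bool (z > 0) * v (q - 1, z - 1)
    + real (z + 1) * nu * of_bool (q < K) * v (q + 1, z + 1)
    + mu * real (z + 1) * of_bool (q \<noteq> z) * v (q, z + 1)
    + (real q - real z + 1) * nu * of_bool (q < K) * v (q + 1, z)"
proof -
  have rate: "v x * jump_rate lam mu nu K K x (q, z) =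
      (if x = (q - 1, z - 1) then lam * of_bool (z > 0) * v x else 0)
      + (if x = (q + 1, z + 1) then real (z + 1) * nu * v x else 0)
      + (if x = (q, z + 1) then mu * real (z + 1) * v x else 0)
      + (if x = (q + 1, z) then (real q - real z + 1) * nu * v x else 0)" if "x \<in> states K" for x
  proof -
    obtain q' z' where x: "x = (q', z')" by (cases x)
    then have qz': "z' \<le> q'" "q' \<le> K" "z' \<le> K" using that by (auto simp: mem_states)
    show ?thesis
      unfolding x jump_rate_full_power[OF qz'(3)] using assms qz'(1,2) by (cases z; cases q) auto
  qed
  have sources: "(q + 1, z + 1) \<in> states K \<longleftrightarrow> q < K"
    "(q, z + 1) \<in> states K \<longleftrightarrow> q \<noteq> z" "(q + 1, z) \<in> states K \<longleftrightarrow> q < K"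
    "(q - 1, z - 1) \<in> states K"
    using assms by (auto simp: mem_states)
  show ?thesis
    by (subst sum.cong[OF refl rate], assumption,
        unfold sum.distrib sum.delta[OF finite_states] sources(1-3), simp add: sources(4)[simplified])
qed

abbreviation station_generator :: "real \<Rightarrow> real \<Rightarrow> real \<Rightarrow> nat \<Rightarrow> nat \<times> nat \<Rightarrow> nat \<times> nat \<Rightarrow> real" where
  "station_generator lam mu nu K \<equiv> generator (states K) (jump_rate lam mu nu K K)"

text \<open>The balance equation at a state equates the outflow to the inflow, and the diagonal of the
  generator is minus the total jump rate.\<close>

lemma balance_equations_iff_stationary:
  "balance_equations lam mu nu K K p \<longleftrightarrow>
    stationary (states K) (station_generator lam mu nu K) (\<lambda>(q, z). p q z)"
proof -
  let ?r = "jump_rate lam mu nu K K" and ?v = "\<lambda>(q, z). p q z"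
  have flow: "(\<Sum>x\<in>states K. v x * station_generator lam mu nu K x y) =
      (\<Sum>x\<in>states K. v x * ?r x y) - v y * (\<Sum>w\<in>states K. ?r y w)" if y: "y \<in> states K" for v y
  proof -
    have "(\<Sum>w\<in>states K - {y}. ?r y w) = (\<Sum>w\<in>states K. ?r y w)"
      using y finite_states[of K] by (simp add: sum.remove jump_rate_self)
    then have "v x * station_generator lam mu nu K x y =
        v x * ?r x y - (if x = y then v y * (\<Sum>w\<in>states K. ?r y w) else 0)" for x
      by (auto simp: generator_def jump_rate_self)
    then show ?thesis using y finite_states[of K] by (simp add: sum_subtractf)
  qed
  have "balance_equations lam mu nu K K p \<longleftrightarrow>
     (\<forall>q z. z \<le> q \<and> q \<le> K \<longrightarrow>
        p q z * (\<Sum>w\<in>states K. ?r (q, z) w) = (\<Sum>x\<in>states K. ?v x * ?r x (q, z)))"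
    unfolding balance_equations_def
  proof (intro iff_allI imp_cong refl)
    fix q z assume "z \<le> q \<and> q \<le> K"
    then have qz: "z \<le> q" "q \<le> K" by auto
    have "power_alloc K z = z" "q \<noteq> z \<Longrightarrow> power_alloc K (z + 1) = z + 1"
      using qz by (auto simp: power_alloc_def)
    then show "((real q * nu * of_bool (q > 0) + lam * of_bool (q < K)
           + mu * real (power_alloc K z) * of_bool (z > 0)) * p q z =
        lam * of_bool (z > 0) * p (q - 1) (z - 1)
        + real (z + 1) * nu * of_bool (q < K) * p (q + 1) (z + 1)
        + mu * real (power_alloc K (z + 1)) * of_bool (q \<noteq> z) * p q (z + 1)
        + (real q - real z + 1) * nu * of_bool (q < K) * p (q + 1) z) =
        (p q z * (\<Sum>w\<in>states K. ?r (q, z) w) = (\<Sum>x\<in>states K. ?v x * ?r x (q, z)))"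
      unfolding total_jump_rate[OF qz] inflow[OF qz]
      by (cases "q = z") (auto simp: algebra_simps)
  qed
  also have "\<dots> \<longleftrightarrow> stationary (states K) (station_generator lam mu nu K) ?v"
  proof -
    have "(\<forall>y\<in>states K. R y) \<longleftrightarrow> (\<forall>q z. z \<le> q \<and> q \<le> K \<longrightarrow> R (q, z))" for R
      by (auto simp: states_def)
    then show ?thesis unfolding stationary_def
      by (simp add: flow mem_states) (metis (no_types))
  qed
  finally show ?thesis .
qed

text \<open>Every state empties by departures of uncharged vehicles followed by charged ones; from the
  empty state, \<open>(q, z)\<close> is reached by \<open>q\<close> arrivals followed by \<open>q - z\<close> completed charges.\<close>

lemma station_irreducible:
  assumes pos: "0 < lam" "0 < mu" "0 < nu"
  shows "irreducible_on (states K) (station_generator lam mu nu K)"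
proof -
  let ?J = "jumps (states K) (station_generator lam mu nu K)"
  have J: "((q, z), (q', z')) \<in> ?J"
    if "(q, z) \<in> states K" "(q', z') \<in> states K" "0 < jump_rate lam mu nu K K (q, z) (q', z')"
    for q z q' z'
    using that jump_rate_self by (auto simp: jumps_def generator_def)
  have down: "((q, z), (0, 0)) \<in> ?J\<^sup>*" if "z \<le> q" "q \<le> K" for q z
    using that
  proof (induction q arbitrary: z)
    case (Suc q)
    \<comment> \<open>For \<open>z = 0\<close> the subtraction truncates and the vehicle that departs is a charged one.\<close>
    have "((Suc q, z), (q, z - 1)) \<in> ?J"
      using Suc.prems pos by (intro J) (auto simp: states_def jump_rate_def power_alloc_def)
    moreover have "((q, z - 1), (0, 0)) \<in> ?J\<^sup>*" using Suc.prems by (intro Suc.IH) auto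
    ultimately show ?case by (rule converse_rtrancl_into_rtrancl)
  qed simp
  have arrive: "((0, 0), (q, q)) \<in> ?J\<^sup>*" if "q \<le> K" for q
    using that
  proof (induction q)
    case (Suc q)
    have "((q, q), (Suc q, Suc q)) \<in> ?J"
      using Suc.prems pos by (intro J) (auto simp: states_def jump_rate_def)
    with Suc show ?case by (auto intro: rtrancl_into_rtrancl)
  qed simp
  have charge: "((q, q), (q, z)) \<in> ?J\<^sup>*" if "z \<le> q" "q \<le> K" for q z
    using that(1)
  proof (induction z rule: inc_induct)
    case (step z)
    have "((q, Suc z), (q, z)) \<in> ?J"
      using step.hyps that(2) pos by (intro J) (auto simp: states_def jump_rate_def power_alloc_def)
    with step.IH show ?case by (rule rtrancl_into_rtrancl)
  qed simp
  show ?thesis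
    unfolding irreducible_on_def
  proof (intro ballI)
    fix x y assume "x \<in> states K" "y \<in> states K"
    then obtain q z q' z' where "x = (q, z)" "z \<le> q" "q \<le> K" "y = (q', z')" "z' \<le> q'" "q' \<le> K"
      by (auto simp: states_def)
    then show "(x, y) \<in> ?J\<^sup>*"
      using rtrancl_trans[OF rtrancl_trans[OF down arrive] charge] by blast
  qed
qed

section \<open>The truncated product of two Poisson laws\<close>

text \<open>The product of Poisson weights with means \<open>a\<close> for the uncharged and \<open>b\<close> for the charged
  vehicles, without the exponential normalization.\<close>

definition poisson_weights :: "real \<Rightarrow> real \<Rightarrow> nat \<Rightarrow> nat \<Rightarrow> real" where
  "poisson_weights a b q z = a ^ z / fact z * (b ^ (q - z) / fact (q - z))"

lemma poisson_weights_pos: "0 < a \<Longrightarrow> 0 < b \<Longrightarrow> 0 < poisson_weights a b q z"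
  by (simp add: poisson_weights_def)

lemma poisson_term_Suc: "real (Suc n) * (a ^ Suc n / fact (Suc n)) = a * (a ^ n / fact n)"
  by (simp add: fact_Suc divide_simps del: of_nat_Suc)

lemma poisson_weights_add_uncharged:
  assumes "z \<le> q"
  shows "real (z + 1) * poisson_weights a b (q + 1) (z + 1) = a * poisson_weights a b q z"
  using poisson_term_Suc[of z a] by (simp add: poisson_weights_def)

lemma poisson_weights_add_charged:
  assumes "z \<le> q"
  shows "(real q - real z + 1) * poisson_weights a b (q + 1) z = b * poisson_weights a b q z"
proof -
  from assms obtain c where "q = z + c" using le_Suc_ex by blast
  then show ?thesis
    using arg_cong[OF poisson_term_Suc[of c b], of "\<lambda>r. a ^ z / fact z * r"]
    by (simp add: poisson_weights_def mult.left_commute add.commute)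
qed

text \<open>Both \<open>(q, z + 1)\<close> and \<open>(q, z)\<close> arise from \<open>(q - 1, z)\<close> by adding one vehicle, so their
  weights are compared through that of \<open>(q - 1, z)\<close>.\<close>

lemma poisson_weights_uncharge:
  assumes "z < q"
  shows "b * (real (z + 1) * poisson_weights a b q (z + 1))
    = a * ((real q - real z) * poisson_weights a b q z)"
proof -
  from assms obtain c where q: "q = z + c + 1"
    by (metis add.assoc less_imp_add_positive Suc_eq_plus1 gr0_implies_Suc)
  then have "b * (real (z + 1) * poisson_weights a b q (z + 1)) = b * (a * poisson_weights a b (z + c) z)"
    using poisson_weights_add_uncharged[of z "z + c" a b] by simp
  also have "\<dots> = a * ((real q - real z) * poisson_weights a b q z)"
    using poisson_weights_add_charged[of z "z + c" a b] q
    by (simp add: mult.left_commute add.commute[of 1])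
  finally show ?thesis .
qed

lemma marginal_poisson_weights: "(\<Sum>z=0..q. poisson_weights a b q z) = (a + b) ^ q / fact q"
proof -
  have "(a + b) ^ q / fact q = (\<Sum>z\<le>q. of_nat (q choose z) * a ^ z * b ^ (q - z) / fact q)"
    by (simp add: binomial_ring sum_divide_distrib)
  also have "\<dots> = (\<Sum>z\<le>q. poisson_weights a b q z)"
    by (intro sum.cong refl) (simp add: poisson_weights_def binomial_fact)
  finally show ?thesis by (simp add: atMost_atLeast0)
qed

lemma sum_states: "(\<Sum>(q, z)\<in>states K. p q z) = (\<Sum>q=0..K. marginal_Q p q)"
proof -
  have "states K = Sigma {0..K} (\<lambda>q. {0..q})" by (auto simp: states_def)
  then show ?thesis by (simp add: sum.Sigma marginal_Q_def)
qed

text \<open>The Poisson means: \<open>lam / nu\<close> is the mean number of parked vehicles without blocking, and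
  charging takes longer than the exponential parking time with probability \<open>nu / (nu + mu)\<close>.\<close>

definition uncharged_load :: "real \<Rightarrow> real \<Rightarrow> real \<Rightarrow> real" where
  "uncharged_load lam mu nu = lam / nu * (nu / (nu + mu))"

definition charged_load :: "real \<Rightarrow> real \<Rightarrow> real \<Rightarrow> real" where
  "charged_load lam mu nu = lam / nu * (mu / (nu + mu))"

text \<open>The traffic equations of the tandem: uncharged vehicles arrive at rate \<open>lam\<close> and leave that
  state at rate \<open>nu + mu\<close> each, and they become charged as fast as charged vehicles depart.\<close>

lemma loads:
  assumes "0 < lam" "0 < mu" "0 < nu"
  defines "a \<equiv> uncharged_load lam mu nu" and "b \<equiv> charged_load lam mu nu"
  shows "0 < a" and "0 < b" and "(nu + mu) * a = lam" and "nu * b = mu * a" and "a + b = lam / nu"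
proof -
  show "0 < a" "0 < b"
    using assms(1-3) by (simp_all add: a_def b_def uncharged_load_def charged_load_def)
  show ab: "(nu + mu) * a = lam" "nu * b = mu * a"
    using assms(1-3) by (simp_all add: a_def b_def uncharged_load_def charged_load_def)
  then have "nu * (a + b) = lam" by (simp add: algebra_simps)
  then show "a + b = lam / nu" using assms(3) by (simp add: field_simps)
qed

text \<open>After division by the weight of \<open>(q, z)\<close>, arrivals into the state contribute
  \<open>(nu + mu) z\<close>, charge completions contribute \<open>nu (q - z)\<close>, and the two kinds of
  departures contribute \<open>nu a + nu b = lam\<close> when \<open>q < K\<close>. These add up to the total rate out of the
  state.\<close>

lemma balance_equations_poisson_weights:
  assumes pos: "0 < lam" "0 < mu" "0 < nu"
  defines "a \<equiv> uncharged_load lam mu nu" and "b \<equiv> charged_load lam mu nu"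
  shows "balance_equations lam mu nu K K (\<lambda>q z. c * poisson_weights a b q z)"
  unfolding balance_equations_def
proof (intro allI impI)
  fix q z assume "z \<le> q \<and> q \<le> K"
  then have qz: "z \<le> q" "q \<le> K" by auto
  let ?w = "poisson_weights a b"
  have ab: "0 < a" "0 < b" "(nu + mu) * a = lam" "nu * b = mu * a"
    unfolding a_def b_def using loads[OF pos] by auto
  then have sum: "nu * a + nu * b = lam" by (simp add: algebra_simps)
  have 1: "lam * of_bool (z > 0) * ?w (q - 1) (z - 1) = (nu + mu) * real z * ?w q z"
  proof (cases z)
    case (Suc z')
    then obtain q' where "q = Suc q'" using qz by (cases q) auto
    have "lam * ?w q' z' = (nu + mu) * (a * ?w q' z')"
      unfolding ab(3)[symmetric] by (rule mult.assoc)
    also have "a * ?w q' z' = real z * ?w q z"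
      using Suc \<open>q = Suc q'\<close> qz poisson_weights_add_uncharged[of z' q' a b] by simp
    finally show ?thesis using Suc \<open>q = Suc q'\<close> by (simp add: mult.assoc)
  qed simp
  have 2: "real (z + 1) * nu * of_bool (q < K) * ?w (q + 1) (z + 1)
      = nu * a * ?w q z * of_bool (q < K)"
    using arg_cong[OF poisson_weights_add_uncharged[OF qz(1), of a b],
        of "\<lambda>r. nu * of_bool (q < K) * r"]
    by (simp only: ac_simps)
  have 3: "mu * real (power_alloc K (z + 1)) * of_bool (q \<noteq> z) * ?w q (z + 1)
      = nu * (real q - real z) * ?w q z"
  proof (cases "q = z")
    case False
    with qz have zq: "z < q" by simp
    \<comment> \<open>The factor \<open>a\<close> lets the traffic equation exchange \<open>mu * a\<close> for \<open>nu * b\<close>.\<close>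
    have "a * (mu * (real (z + 1) * ?w q (z + 1))) = nu * (b * (real (z + 1) * ?w q (z + 1)))"
      using ab(4) by simp
    also have "\<dots> = a * (nu * ((real q - real z) * ?w q z))"
      using poisson_weights_uncharge[OF zq, of b a] by simp
    finally have "mu * (real (z + 1) * ?w q (z + 1)) = nu * ((real q - real z) * ?w q z)"
      using ab(1) by simp
    then show ?thesis using zq qz by (simp add: power_alloc_def mult.assoc)
  qed simp
  have 4: "(real q - real z + 1) * nu * of_bool (q < K) * ?w (q + 1) z
      = nu * b * ?w q z * of_bool (q < K)"
    using arg_cong[OF poisson_weights_add_charged[OF qz(1), of a b],
        of "\<lambda>r. nu * of_bool (q < K) * r"]
    by (simp only: ac_simps)
  have "(real q * nu * of_bool (q > 0) + lam * of_bool (q < K)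
           + mu * real (power_alloc K z) * of_bool (z > 0)) * ?w q z
      = (real q * nu + (nu * a + nu * b) * of_bool (q < K) + mu * real z) * ?w q z"
    using qz sum by (auto simp: power_alloc_def)
  also have "\<dots> = lam * of_bool (z > 0) * ?w (q - 1) (z - 1)
        + real (z + 1) * nu * of_bool (q < K) * ?w (q + 1) (z + 1)
        + mu * real (power_alloc K (z + 1)) * of_bool (q \<noteq> z) * ?w q (z + 1)
        + (real q - real z + 1) * nu * of_bool (q < K) * ?w (q + 1) z"
    unfolding 1 2 3 4 by (simp add: algebra_simps)
  finally have "c * ((real q * nu * of_bool (q > 0) + lam * of_bool (q < K)
           + mu * real (power_alloc K z) * of_bool (z > 0)) * ?w q z)
      = c * (lam * of_bool (z > 0) * ?w (q - 1) (z - 1)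
        + real (z + 1) * nu * of_bool (q < K) * ?w (q + 1) (z + 1)
        + mu * real (power_alloc K (z + 1)) * of_bool (q \<noteq> z) * ?w q (z + 1)
        + (real q - real z + 1) * nu * of_bool (q < K) * ?w (q + 1) z)"
    by (rule arg_cong)
  then show "(real q * nu * of_bool (q > 0) + lam * of_bool (q < K)
           + mu * real (power_alloc K z) * of_bool (z > 0)) * (c * ?w q z) =
        lam * of_bool (z > 0) * (c * ?w (q - 1) (z - 1))
        + real (z + 1) * nu * of_bool (q < K) * (c * ?w (q + 1) (z + 1))
        + mu * real (power_alloc K (z + 1)) * of_bool (q \<noteq> z) * (c * ?w q (z + 1))
        + (real q - real z + 1) * nu * of_bool (q < K) * (c * ?w (q + 1) z)"
    by (simp only: distrib_left mult.assoc mult.left_commute[of _ c])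
qed

theorem proposition3p2:
  fixes lam mu nu :: real and K M :: nat
  assumes "lam > 0" and "mu > 0" and "nu > 0" and "K > 0" and "M = K"
  shows "(\<exists>p. balance_equations lam mu nu K M p \<and> normalized K p) \<and>
    (\<forall>p. balance_equations lam mu nu K M p \<and> normalized K p \<longrightarrow>
       (\<forall>(N :: 'w measure) Q Z. charging_process lam mu nu K M N Q Z \<longrightarrow>
          (\<forall>q z. z \<le> q \<and> q \<le> K \<longrightarrow>
             ((\<lambda>t. \<P>(\<omega> in N. Q t \<omega> = q \<and> Z t \<omega> = z)) \<longlongrightarrow> p q z) at_top)) \<and>
       (\<forall>q z. z \<le> q \<and> q \<le> K \<longrightarrow>
          p q z = marginal_Q p q * (fact q / (fact z * fact (q - z)))
                    * (mu / (nu + mu)) ^ (q - z) * (nu / (nu + mu)) ^ z) \<and>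
       (\<forall>q\<le>K. marginal_Q p q = 1 / fact q * (lam / nu) ^ q * marginal_Q p 0) \<and>
       p 0 0 = marginal_Q p 0 \<and>
       marginal_Q p 0 = inverse (\<Sum>i=0..K. 1 / fact i * (lam / nu) ^ i))"
proof -
  note pos = assms(1-3)
  let ?S = "states K" and ?G = "station_generator lam mu nu K"
  define a where "a = uncharged_load lam mu nu"
  define b where "b = charged_load lam mu nu"
  define c where "c = inverse (\<Sum>i=0..K. 1 / fact i * (lam / nu) ^ i)"
  define p\<^sub>e where "p\<^sub>e q z = c * poisson_weights a b q z" for q z
  have ab: "0 < a" "0 < b" "a + b = lam / nu"
    unfolding a_def b_def using loads[OF pos] by auto
  have norm_pos: "0 < (\<Sum>i=0..K. 1 / fact i * (lam / nu) ^ i)"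
    using pos by (intro sum_pos) auto
  then have c: "0 < c" by (simp add: c_def)
  have marg_e: "marginal_Q p\<^sub>e q = c * (1 / fact q * (lam / nu) ^ q)" for q
    using marginal_poisson_weights[of a b q]
    by (simp add: marginal_Q_def p\<^sub>e_def ab(3) flip: sum_distrib_left)
  have bal_e: "balance_equations lam mu nu K K p\<^sub>e"
    using balance_equations_poisson_weights[OF pos, of K c] by (simp add: p\<^sub>e_def[abs_def] a_def b_def)
  have norm_e: "normalized K p\<^sub>e"
  proof -
    have "(\<Sum>(q, z)\<in>states K. p\<^sub>e q z) = c * (\<Sum>q=0..K. 1 / fact q * (lam / nu) ^ q)"
      by (simp only: sum_states marg_e sum_distrib_left)
    also have "\<dots> = 1"
      unfolding c_def using norm_pos by (intro left_inverse) simp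
    finally show ?thesis by (simp only: normalized_def)
  qed
  have unique: "p q z = p\<^sub>e q z"
    if "balance_equations lam mu nu K K p" "normalized K p" "z \<le> q" "q \<le> K" for p q z
  proof -
    have "(\<lambda>(q, z). p q z) (q, z) = (\<lambda>(q, z). p\<^sub>e q z) (q, z)"
    proof (rule stationary_unique[OF finite_states station_irreducible[OF pos, of K]])
      show "0 \<le> ?G x y" if "x \<in> ?S" "x \<noteq> y" for x y
        using that pos by (simp add: generator_off_diagonal jump_rate_nonneg)
      show "0 < (\<lambda>(q, z). p\<^sub>e q z) x" for x
        using c ab by (cases x) (simp add: p\<^sub>e_def poisson_weights_pos)
    qed (use that bal_e norm_e in
        \<open>auto simp: normalized_def mem_states simp flip: balance_equations_iff_stationary\<close>)
    then show ?thesis by simp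
  qed
  show ?thesis
    unfolding \<open>M = K\<close>
  proof (rule conjI, rule exI[of _ p\<^sub>e], rule conjI[OF bal_e norm_e],
      rule allI, rule impI, elim conjE)
    fix p assume bal: "balance_equations lam mu nu K K p" and norm: "normalized K p"
    note eq = unique[OF bal norm]
    have marg: "marginal_Q p q = c * (1 / fact q * (lam / nu) ^ q)" if "q \<le> K" for q
      using that marg_e[of q] eq by (simp add: marginal_Q_def)
    have limit: "((\<lambda>t. \<P>(\<omega> in N. Q t \<omega> = q \<and> Z t \<omega> = z)) \<longlongrightarrow> p q z) at_top"
      if "charging_process lam mu nu K K N Q Z" "z \<le> q" "q \<le> K" for N :: "'w measure" and Q Z q z
      using ctmc_tendsto_stationary[OF finite_states station_irreducible[OF pos], of K
          "\<lambda>(q, z). p q z" N "\<lambda>t \<omega>. (Q t \<omega>, Z t \<omega>)" "(q, z)"] that bal norm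
      by (simp add: charging_process_def normalized_def mem_states
          flip: balance_equations_iff_stationary)
    have cond: "p q z = marginal_Q p q * (fact q / (fact z * fact (q - z)))
        * (mu / (nu + mu)) ^ (q - z) * (nu / (nu + mu)) ^ z" if qz: "z \<le> q" "q \<le> K" for q z
    proof -
      have "a ^ z * b ^ (q - z) = (lam / nu) ^ z * (lam / nu) ^ (q - z)
          * (mu / (nu + mu)) ^ (q - z) * (nu / (nu + mu)) ^ z"
        unfolding a_def b_def uncharged_load_def charged_load_def power_mult_distrib
        by (simp only: ac_simps)
      also have "(lam / nu) ^ z * (lam / nu) ^ (q - z) = (lam / nu) ^ q"
        using qz by (simp only: le_add_diff_inverse flip: power_add)
      finally have "a ^ z * b ^ (q - z)
          = (lam / nu) ^ q * (mu / (nu + mu)) ^ (q - z) * (nu / (nu + mu)) ^ z" .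
      moreover have "p q z = c * (a ^ z * b ^ (q - z)) / (fact z * fact (q - z))"
        using eq[OF qz] by (simp add: p\<^sub>e_def poisson_weights_def)
      ultimately show ?thesis using marg[OF qz(2)] by simp
    qed
    show "(\<forall>(N :: 'w measure) Q Z. charging_process lam mu nu K K N Q Z \<longrightarrow>
          (\<forall>q z. z \<le> q \<and> q \<le> K \<longrightarrow>
             ((\<lambda>t. \<P>(\<omega> in N. Q t \<omega> = q \<and> Z t \<omega> = z)) \<longlongrightarrow> p q z) at_top)) \<and>
       (\<forall>q z. z \<le> q \<and> q \<le> K \<longrightarrow>
          p q z = marginal_Q p q * (fact q / (fact z * fact (q - z)))
                    * (mu / (nu + mu)) ^ (q - z) * (nu / (nu + mu)) ^ z) \<and>
       (\<forall>q\<le>K. marginal_Q p q = 1 / fact q * (lam / nu) ^ q * marginal_Q p 0) \<and>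
       p 0 0 = marginal_Q p 0 \<and>
       marginal_Q p 0 = inverse (\<Sum>i=0..K. 1 / fact i * (lam / nu) ^ i)"
    proof (intro conjI)
      show "marginal_Q p 0 = inverse (\<Sum>i=0..K. 1 / fact i * (lam / nu) ^ i)"
        using marg[of 0] by (simp add: c_def)
      show "\<forall>q\<le>K. marginal_Q p q = 1 / fact q * (lam / nu) ^ q * marginal_Q p 0"
        using marg marg[of 0] by simp
      show "p 0 0 = marginal_Q p 0" by (simp add: marginal_Q_def)
    qed (intro allI impI, elim conjE, erule (2) limit, intro allI impI, elim conjE, erule (1) cond)
  qed
qed

end
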